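(* Let $\boldsymbol X^*=(X_{1^*},\dots,X_{d^*})$ be an arbitrarily ordered recursive max-linear (ML) vector with ML coefficient matrix $A^*$ satisfying assumptions (A1)-(A3) of the context, and let $\boldsymbol X_\nu$ be its reordering on a well-ordered DAG. For $a>0$ and $m^*\in\{1^*,\dots,d^*\}$ let $M_{-m^*,am^*}$ be the maximum of $aX_{m^*}$ and of all $X_{k^*}$ with $k^*\neq m^*$, and let $M_{1,\dots,d}$ be the maximum of all components of $\boldsymbol X^*$. (a) If $m^*\in\{1^*,\dots,d^*\}$ is an initial node of the recursive ML vector $\boldsymbol X_\nu$ in a well-ordered DAG, then for all scalars $a>1$ $$\sigma^2_{M_{-m^*,am^*}}-\sigma^2_{M_{1,\dots,d}}=a^2-1.\qquad(\ast)$$ (b) If there exists a scalar $a>1$ such that $(\ast)$ holds for $m^*\in\{1^*,\dots,d^*\}$, then $m^*$ is an initial node of the recursive ML vector $\boldsymbol X_\nu$ in a well-ordered DAG.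
   Context: Recursive ML vector. Let $\mathcal D=(V,E)$ be a DAG with nodes $V=\{1,\dots,d\}$; $\mathrm{pa}(i)$ are the parents of $i$, $\mathrm{an}(i)$ the ancestors of $i$ (not including $i$), $\mathrm{An}(i)=\mathrm{an}(i)\cup\{i\}$. A node $i$ is initial if $\mathrm{pa}(i)=\emptyset$. $\mathcal D$ is well-ordered if $i<j$ for all $i\in V$ and $j\in\mathrm{pa}(i)$. An innovations vector $\boldsymbol Z=(Z_1,\dots,Z_d)$ has independent, atom-free components with support $\mathbb R_+$. Given edge weights $c_{ik}>0$ for $k\in\mathrm{pa}(i)\cup\{i\}$, define $X_i=\bigvee_{k\in\mathrm{pa}(i)}c_{ik}X_k\vee c_{ii}Z_i$. For a path $p=[j\to k_1\to\cdots\to k_l=i]$ put $d(p)=c_{jj}c_{k_1j}\cdots c_{ik_{l-1}}$; let $a_{ij}=\max_p d(p)$ over all paths from $j$ to $i$ if $j\in\mathrm{an}(i)$, $a_{ii}=c_{ii}$, and $a_{ij}=0$ if $j\notin\mathrm{An}(i)$. Then $X_i=\bigvee_{j=1}^d a_{ij}Z_j$, written $\boldsymbol X=A\times_{\max}\boldsymbol Z$; $\boldsymbol X$ is called a recursive ML vector and $A=(a_{ij})$ its ML coefficient matrix. Arbitrarily ordered vector. $\boldsymbol X^*=A^*\times_{\max}\boldsymbol Z$, $A^*=(a_{i^*k})$, is obtained by permuting rows: there is a bijection $\nu:\{1^*,\dots,d^*\}\to\{1,\dots,d\}$ with $a_{i^*k}=a_{\nu(i^* )k}$ and $X_{i^*}=X_{\nu(i^*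 )}$, where $A=A_\nu=(a_{ik})$ is the (upper triangular) ML coefficient matrix of the recursive ML vector $\boldsymbol X_\nu=A\times_{\max}\boldsymbol Z$ on a well-ordered DAG. Saying that $m^*$ is an initial node means that $\nu(m^* )$ is an initial node of this DAG. Regular variation. $\boldsymbol Y\in\mathbb R^d_+$ is in $RV^d_+(2)$ (with normalizing sequence $b_n=\sqrt n$ and the Euclidean norm) if, for $R=\|\boldsymbol Y\|_2$ and $\boldsymbol\omega=\boldsymbol Y/R$, $n\mathbb P[(R/\sqrt n,\boldsymbol\omega)\in\cdot]\to\nu_2\times H_{\boldsymbol Y}$ vaguely on $(0,\infty]\times\Theta_+^{d-1}$, where $d\nu_2(x)=2x^{-3}dx$, $\Theta_+^{d-1}=\{\boldsymbol\omega\in\mathbb R_+^d:\|\boldsymbol\omega\|_2=1\}$ and $H_{\boldsymbol Y}$ is a finite (spectral) measure. Scalings. For $Y\in RV^1_+(2)$ the squared scaling is $\sigma_Y^2=\lim_{n\to\infty}n\mathbb P(Y>\sqrt n)$. Assumptions. (A1) $\boldsymbol Z\in RV^d_+(2)$ has independent and standardized components: $n\mathbb P(n^{-1/2}Z_i>x)\to x^{-2}$ for all $x>0$ and all $i$. (A2) The norm is the Euclidean norm. (A3) The ML coefficient matrix is standardized, i.e. $a_{ij}$ is replaced by $a_{ij}/(\sum_{k=1}^da_{ik}^2)^{1/2}$, so that every row has Euclidean norm $1$. *)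

theory Defs
  imports "HOL-Probability.Probability"
begin

section \<open>Recursive max-linear vectors\<close>

text \<open>
  A graph on the node type \<open>'n\<close> is its edge relation; \<open>(k, i) \<in> E\<close> is the edge from \<open>k\<close> to \<open>i\<close>,
  with weight \<open>c i k\<close>; \<open>c i i\<close> is the weight of the innovation of node \<open>i\<close>.
\<close>

definition parents :: "'n rel \<Rightarrow> 'n \<Rightarrow> 'n set" where
  "parents E i = {k. (k, i) \<in> E}"

definition ancestors :: "'n rel \<Rightarrow> 'n \<Rightarrow> 'n set" where
  "ancestors E i = {j. (j, i) \<in> E\<^sup>+}"

definition initial_node :: "'n rel \<Rightarrow> 'n \<Rightarrow> bool" where
  "initial_node E i \<longleftrightarrow> parents E i = {}"

text \<open>Parents carry the larger labels, so the coefficient matrix is upper triangular.\<close>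

definition well_ordered :: "'n::linorder rel \<Rightarrow> bool" where
  "well_ordered E \<longleftrightarrow> (\<forall>i. \<forall>j\<in>parents E i. i < j)"

definition positive_weights :: "'n rel \<Rightarrow> ('n \<Rightarrow> 'n \<Rightarrow> real) \<Rightarrow> bool" where
  "positive_weights E c \<longleftrightarrow> (\<forall>i. \<forall>k\<in>parents E i \<union> {i}. 0 < c i k)"

definition recursive_ml_vector ::
  "'w measure \<Rightarrow> 'n::finite rel \<Rightarrow> ('n \<Rightarrow> 'n \<Rightarrow> real) \<Rightarrow>
   ('w \<Rightarrow> real^'n) \<Rightarrow> ('w \<Rightarrow> real^'n) \<Rightarrow> bool" where
  "recursive_ml_vector M E c Z X \<longleftrightarrow>
     acyclic E \<and> positive_weights E c \<and>
     (\<forall>w\<in>space M. \<forall>i.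
        X w $ i = Max (insert (c i i * Z w $ i) ((\<lambda>k. c i k * X w $ k) ` parents E i)))"

definition paths :: "'n rel \<Rightarrow> 'n \<Rightarrow> 'n \<Rightarrow> 'n list set" where
  "paths E j i = {p. 2 \<le> length p \<and> hd p = j \<and> last p = i \<and>
     successively (\<lambda>k l. (k, l) \<in> E) p}"

definition path_weight :: "('n \<Rightarrow> 'n \<Rightarrow> real) \<Rightarrow> 'n list \<Rightarrow> real" where
  "path_weight c p = c (hd p) (hd p) * (\<Prod>k<length p - 1. c (p ! Suc k) (p ! k))"

text \<open>The maximum below is over a finite set because it is only used for acyclic \<open>E\<close>.\<close>

definition ml_coeff :: "'n rel \<Rightarrow> ('n \<Rightarrow> 'n \<Rightarrow> real) \<Rightarrow> 'n \<Rightarrow> 'n \<Rightarrow> real" where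
  "ml_coeff E c i j =
     (if j = i then c i i
      else if j \<in> ancestors E i then Max (path_weight c ` paths E j i)
      else 0)"

definition ml_coeff_matrix :: "'n::finite rel \<Rightarrow> ('n \<Rightarrow> 'n \<Rightarrow> real) \<Rightarrow> real^'n^'n" where
  "ml_coeff_matrix E c = (\<chi> i j. ml_coeff E c i j)"

definition max_times :: "real^'n^'m \<Rightarrow> real^'n \<Rightarrow> real^'m" where
  "max_times A z = (\<chi> i. Max (range (\<lambda>j. A $ i $ j * z $ j)))"


subsection \<open>Max-linear representation\<close>

lemma finite_paths:
  fixes E :: "'n::finite rel"
  assumes "acyclic E"
  shows "finite (paths E j i)"
proof -
  have dist: "distinct p" if "successively (\<lambda>k l. (k, l) \<in> E) p" for p
  proof -
    have "successively (\<lambda>k l. (k, l) \<in> E\<^sup>+) p"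
      using that by (rule successively_mono) auto
    then have "sorted_wrt (\<lambda>k l. (k, l) \<in> E\<^sup>+) p"
      by (subst (asm) successively_iff_sorted_wrt_strong) (auto intro: trancl_trans)
    then show ?thesis
      using assms by (induction p) (auto simp: acyclic_def)
  qed
  have "paths E j i \<subseteq> {p. set p \<subseteq> UNIV \<and> distinct p}"
    using dist by (auto simp: paths_def)
  moreover have "finite {p. set p \<subseteq> (UNIV::'n set) \<and> distinct p}"
    by (rule finite_subset_distinct) simp
  ultimately show ?thesis
    by (rule finite_subset)
qed

lemma path_weight_snoc:
  assumes "p \<noteq> []"
  shows "path_weight c (p @ [i]) = c i (last p) * path_weight c p"
proof -
  obtain n where n: "length p = Suc n"
    using assms by (cases p) auto
  have "(\<Prod>k<n. c ((p @ [i]) ! Suc k) ((p @ [i]) ! k)) = (\<Prod>k<n. c (p ! Suc k) (p ! k))"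
    by (rule prod.cong) (auto simp: nth_append n)
  moreover have "(p @ [i]) ! Suc n = i" "(p @ [i]) ! n = last p"
    using assms n by (auto simp: nth_append last_conv_nth)
  ultimately show ?thesis
    using assms n by (simp add: path_weight_def)
qed

lemma path_imp_trancl:
  assumes "p \<in> paths E j i"
  shows "(j, i) \<in> E\<^sup>+"
  using assms
proof (induction p arbitrary: i rule: rev_induct)
  case Nil
  then show ?case by (simp add: paths_def)
next
  case (snoc x p)
  show ?case
  proof (cases "2 \<le> length p")
    case True
    then have "p \<noteq> []" by auto
    with True have "p \<in> paths E j (last p)" and e: "(last p, i) \<in> E"
      using snoc.prems by (auto simp: paths_def successively_append_iff)
    from snoc.IH[OF this(1)] e show ?thesis by (rule trancl_into_trancl)
  next
    case False
    then obtain y where "p = [y]"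
      using snoc.prems by (cases p; cases "tl p") (auto simp: paths_def)
    then show ?thesis
      using snoc.prems by (auto simp: paths_def)
  qed
qed

lemma trancl_imp_path:
  assumes "(j, i) \<in> E\<^sup>+"
  shows "paths E j i \<noteq> {}"
  using assms
proof induction
  case (base i)
  then have "[j, i] \<in> paths E j i" by (auto simp: paths_def)
  then show ?case by blast
next
  case (step k i)
  then obtain p where p: "p \<in> paths E j k" by blast
  then have "p \<noteq> []" by (auto simp: paths_def)
  with p have "p @ [i] \<in> paths E j i"
    using step.hyps by (auto simp: paths_def successively_append_iff)
  then show ?case by blast
qed

lemma recursive_ml_vector_max_times:
  fixes Z X :: "'w \<Rightarrow> real^('n::finite)"
  assumes rml: "recursive_ml_vector M E c Z X"
    and w: "w \<in> space M"
    and nonneg: "\<And>j. 0 \<le> Z w $ j"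
  shows "X w = max_times (ml_coeff_matrix E c) (Z w)"
proof -
  have acyc: "acyclic E"
    and cpos: "\<And>i k. k \<in> parents E i \<union> {i} \<Longrightarrow> 0 < c i k"
    and rec: "\<And>i. X w $ i =
      Max (insert (c i i * Z w $ i) ((\<lambda>k. c i k * X w $ k) ` parents E i))"
    using rml w unfolding recursive_ml_vector_def positive_weights_def by blast+
  have le: "path_weight c p * Z w $ hd p \<le> X w $ last p"
    if "p \<noteq> []" "successively (\<lambda>k l. (k, l) \<in> E) p" for p
    using that
  proof (induction p rule: rev_induct)
    case Nil
    then show ?case by simp
  next
    case (snoc i p)
    show ?case
    proof (cases "p = []")
      case True
      then show ?thesis by (subst rec) (simp add: path_weight_def)
    next
      case False
      then have e: "(last p, i) \<in> E" and s: "successively (\<lambda>k l. (k, l) \<in> E) p"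
        using snoc.prems by (auto simp: successively_append_iff)
      have "c i (last p) * (path_weight c p * Z w $ hd p) \<le> c i (last p) * X w $ last p"
        using snoc.IH[OF False s] cpos[of "last p" i] e
        by (intro mult_left_mono) (auto simp: parents_def)
      also have "\<dots> \<le> X w $ i"
        using e by (subst (2) rec) (auto simp: parents_def intro!: Max_ge)
      finally show ?thesis
        using False by (simp add: path_weight_snoc mult.assoc)
    qed
  qed
  have wfE: "wf E"
    using acyc by (intro finite_acyclic_wf) auto
  have attained: "\<exists>p. p \<noteq> [] \<and> successively (\<lambda>k l. (k, l) \<in> E) p \<and> last p = i \<and>
      X w $ i = path_weight c p * Z w $ hd p" for i
    using wfE
  proof (induction i rule: wf_induct_rule)
    case (less i)
    have "X w $ i \<in> insert (c i i * Z w $ i) ((\<lambda>k. c i k * X w $ k) ` parents E i)"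
      by (subst rec, rule Max_in) auto
    then consider "X w $ i = c i i * Z w $ i"
      | k where "(k, i) \<in> E" "X w $ i = c i k * X w $ k"
      by (auto simp: parents_def)
    then show ?case
    proof cases
      case 1
      then show ?thesis by (intro exI[of _ "[i]"]) (simp add: path_weight_def)
    next
      case 2
      obtain p where "p \<noteq> []" "successively (\<lambda>k l. (k, l) \<in> E) p" "last p = k"
        "X w $ k = path_weight c p * Z w $ hd p"
        using less.IH[OF 2(1)] by blast
      then show ?thesis
        using 2 by (intro exI[of _ "p @ [i]"])
          (auto simp: path_weight_snoc successively_append_iff)
    qed
  qed
  have coeff: "path_weight c p \<le> ml_coeff E c (last p) (hd p)"
    if p: "p \<noteq> []" "successively (\<lambda>k l. (k, l) \<in> E) p" for p
  proof (cases "2 \<le> length p")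
    case True
    then have P: "p \<in> paths E (hd p) (last p)"
      using p by (simp add: paths_def)
    have "(hd p, last p) \<in> E\<^sup>+" using path_imp_trancl[OF P] .
    moreover from this have "hd p \<noteq> last p" using acyc by (auto simp: acyclic_def)
    ultimately show ?thesis
      using P finite_paths[OF acyc] by (auto simp: ml_coeff_def ancestors_def intro!: Max_ge)
  next
    case False
    then obtain y where "p = [y]" using p by (cases p; cases "tl p") auto
    then show ?thesis by (simp add: ml_coeff_def path_weight_def)
  qed
  have X_nonneg: "0 \<le> X w $ i" for i
  proof -
    have "0 \<le> c i i * Z w $ i" using cpos[of i i] nonneg by simp
    also have "\<dots> \<le> X w $ i" by (subst rec) simp
    finally show ?thesis .
  qed
  have "X w $ i = Max (range (\<lambda>j. ml_coeff E c i j * Z w $ j))" for i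
  proof (rule sym, rule Max_eqI)
    show "finite (range (\<lambda>j. ml_coeff E c i j * Z w $ j))" by simp
  next
    fix y assume "y \<in> range (\<lambda>j. ml_coeff E c i j * Z w $ j)"
    then obtain j where y: "y = ml_coeff E c i j * Z w $ j" by auto
    consider "j = i" | "j \<noteq> i" "j \<in> ancestors E i" | "j \<noteq> i" "j \<notin> ancestors E i" by blast
    then show "y \<le> X w $ i"
    proof cases
      case 1
      then show ?thesis using y le[of "[i]"] by (simp add: ml_coeff_def path_weight_def)
    next
      case 2
      then have "ml_coeff E c i j = Max (path_weight c ` paths E j i)"
        by (simp add: ml_coeff_def)
      also have "\<dots> \<in> path_weight c ` paths E j i"
        using 2 finite_paths[OF acyc] trancl_imp_path[of j i E]
        by (intro Max_in) (auto simp: ancestors_def)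
      finally obtain p where "p \<in> paths E j i" "ml_coeff E c i j = path_weight c p" by auto
      then show ?thesis using y le[of p] by (cases "p = []") (auto simp: paths_def)
    next
      case 3
      then show ?thesis using y X_nonneg by (simp add: ml_coeff_def)
    qed
  next
    obtain p where p: "p \<noteq> []" "successively (\<lambda>k l. (k, l) \<in> E) p" "last p = i"
      "X w $ i = path_weight c p * Z w $ hd p"
      using attained by blast
    have "path_weight c p * Z w $ hd p \<le> ml_coeff E c i (hd p) * Z w $ hd p"
      using coeff[OF p(1,2)] p(3) nonneg by (intro mult_right_mono) auto
    moreover have "ml_coeff E c i (hd p) * Z w $ hd p \<le> X w $ i"
    proof (cases "hd p = i")
      case True
      then show ?thesis using le[of "[i]"] by (simp add: ml_coeff_def path_weight_def)
    next
      case False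
      then have "2 \<le> length p"
        using p by (cases p; cases "tl p") auto
      then have P: "p \<in> paths E (hd p) i" using p by (simp add: paths_def)
      have "ml_coeff E c i (hd p) = Max (path_weight c ` paths E (hd p) i)"
        using False path_imp_trancl[OF P] by (simp add: ml_coeff_def ancestors_def)
      also have "\<dots> \<in> path_weight c ` paths E (hd p) i"
        using P finite_paths[OF acyc] by (intro Max_in) auto
      finally obtain q where "q \<in> paths E (hd p) i"
        "ml_coeff E c i (hd p) = path_weight c q" by auto
      then show ?thesis using le[of q] by (cases "q = []") (auto simp: paths_def)
    qed
    ultimately show "X w $ i \<in> range (\<lambda>j. ml_coeff E c i j * Z w $ j)"
      using p(4) by (intro image_eqI[of _ _ "hd p"]) auto
  qed
  then show ?thesis
    by (simp add: vec_eq_iff max_times_def ml_coeff_matrix_def)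
qed

text \<open>
  Dividing the rows of a coefficient matrix by positive numbers \<open>s i\<close> gives the coefficient matrix
  for rescaled weights on the same graph. With \<open>s i\<close> the norm of row \<open>i\<close>, every recursive
  max-linear vector is thus brought to standardized form, and assuming rows of norm 1 is no
  loss of generality.
\<close>

lemma ml_coeff_rescale:
  fixes E :: "'n::finite rel" and c :: "'n \<Rightarrow> 'n \<Rightarrow> real" and s :: "'n \<Rightarrow> real"
  assumes acyc: "acyclic E" and s: "\<And>i. 0 < s i"
  defines "c' \<equiv> \<lambda>i k. if k = i then c i i / s i else c i k * s k / s i"
  shows "ml_coeff E c' i j = ml_coeff E c i j / s i"
proof -
  have wt: "path_weight c' p = path_weight c p / s (last p)"
    if "p \<noteq> []" "successively (\<lambda>k l. (k, l) \<in> E) p" for p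
    using that
  proof (induction p rule: rev_induct)
    case Nil
    then show ?case by simp
  next
    case (snoc i p)
    show ?case
    proof (cases "p = []")
      case True
      then show ?thesis by (simp add: path_weight_def c'_def)
    next
      case False
      then have e: "(last p, i) \<in> E" and su: "successively (\<lambda>k l. (k, l) \<in> E) p"
        using snoc.prems by (auto simp: successively_append_iff)
      have "last p \<noteq> i" using e acyc by (auto simp: acyclic_def)
      then show ?thesis
        using snoc.IH[OF False su] False s[of "last p"]
        by (simp add: path_weight_snoc c'_def)
    qed
  qed
  have "Max (path_weight c' ` paths E j i) = Max (path_weight c ` paths E j i) / s i"
    if "j \<in> ancestors E i"
  proof -
    have "path_weight c' p = path_weight c p / s i" if "p \<in> paths E j i" for p
      using that wt[of p] by (cases "p = []") (auto simp: paths_def)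
    then have "path_weight c' ` paths E j i = (\<lambda>x. x / s i) ` path_weight c ` paths E j i"
      unfolding image_image by (rule image_cong[OF refl])
    moreover have "mono (\<lambda>x. x / s i)"
      using s[of i] by (auto intro!: monoI divide_right_mono)
    then have "Max (path_weight c ` paths E j i) / s i =
        Max ((\<lambda>x. x / s i) ` path_weight c ` paths E j i)"
      by (rule mono_Max_commute)
        (use that finite_paths[OF acyc] trancl_imp_path[of j i E] in \<open>auto simp: ancestors_def\<close>)
    ultimately show ?thesis by simp
  qed
  then show ?thesis
    by (simp add: ml_coeff_def c'_def)
qed


section \<open>Innovations and regular variation\<close>

definition measure_support :: "'a::topological_space measure \<Rightarrow> 'a set" where
  "measure_support \<mu> = {x. \<forall>U. open U \<and> x \<in> U \<longrightarrow> 0 < emeasure \<mu> U}"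

definition innovations :: "'w measure \<Rightarrow> ('w \<Rightarrow> real^'n::finite) \<Rightarrow> bool" where
  "innovations M Z \<longleftrightarrow>
     prob_space.indep_vars M (\<lambda>_. borel) (\<lambda>i w. Z w $ i) UNIV \<and>
     (\<forall>i x. measure M {w \<in> space M. Z w $ i = x} = 0) \<and>
     (\<forall>i. measure_support (distr M borel (\<lambda>w. Z w $ i)) = {0..})"

text \<open>
  Vague convergence on a locally compact subspace \<open>S\<close>: test functions are the continuous
  functions on \<open>S\<close> that vanish off a compact subset of \<open>S\<close>. Mass outside \<open>S\<close> is ignored.
\<close>

definition vague_limit_on ::
  "'a::topological_space set \<Rightarrow> (nat \<Rightarrow> 'a measure) \<Rightarrow> 'a measure \<Rightarrow> bool" where
  "vague_limit_on S \<mu> \<nu> \<longleftrightarrow>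
     (\<forall>(f :: 'a \<Rightarrow> real) K.
        continuous_on S f \<and> compact K \<and> K \<subseteq> S \<and> (\<forall>x\<in>S - K. f x = 0) \<longrightarrow>
        (\<lambda>n. set_lebesgue_integral (\<mu> n) S f) \<longlonglongrightarrow> set_lebesgue_integral \<nu> S f)"

text \<open>
  The radial part lives on \<open>(0, \<infinity>]\<close>, whose compact subsets are bounded away from 0 but may
  contain \<open>\<infinity>\<close>; hence the extended reals.
\<close>

definition radial_measure :: "ereal measure" where
  "radial_measure =
     distr (density lborel (\<lambda>x. indicator {0<..} x * ennreal (2 / x ^ 3))) borel ereal"

definition pos_sphere :: "(real^'n::finite) set" where
  "pos_sphere = {\<omega>. norm \<omega> = 1 \<and> (\<forall>i. 0 \<le> \<omega> $ i)}"

text \<open>The norm of \<open>real^'n\<close> is the Euclidean norm.\<close>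

definition regularly_varying2 :: "'w measure \<Rightarrow> ('w \<Rightarrow> real^'n::finite) \<Rightarrow> bool" where
  "regularly_varying2 M Y \<longleftrightarrow>
     Y \<in> borel_measurable M \<and> (AE w in M. \<forall>i. 0 \<le> Y w $ i) \<and>
     (\<exists>H :: (real^'n) measure.
        finite_measure H \<and> sets H = sets borel \<and> emeasure H (- pos_sphere) = 0 \<and>
        vague_limit_on ({0<..} \<times> pos_sphere)
          (\<lambda>n. scale_measure (of_nat n)
             (distr M borel (\<lambda>w. (ereal (norm (Y w) / sqrt (real n)), Y w /\<^sub>R norm (Y w)))))
          (radial_measure \<Otimes>\<^sub>M H))"

definition standardized_tail :: "'w measure \<Rightarrow> ('w \<Rightarrow> real) \<Rightarrow> bool" where
  "standardized_tail M Y \<longleftrightarrow>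
     (\<forall>x>0. (\<lambda>n. real n * measure M {w \<in> space M. x < Y w / sqrt (real n)}) \<longlonglongrightarrow> 1 / x\<^sup>2)"


section \<open>Squared scalings of maxima\<close>

definition scaling_seq :: "'w measure \<Rightarrow> ('w \<Rightarrow> real) \<Rightarrow> nat \<Rightarrow> real" where
  "scaling_seq M Y n = real n * measure M {w \<in> space M. sqrt (real n) < Y w}"

definition sq_scaling :: "'w measure \<Rightarrow> ('w \<Rightarrow> real) \<Rightarrow> real" where
  "sq_scaling M Y = lim (scaling_seq M Y)"

definition max_all :: "real^'m::finite \<Rightarrow> real" where
  "max_all x = Max (range (\<lambda>k. x $ k))"

definition max_scaled :: "real \<Rightarrow> 'm \<Rightarrow> real^'m::finite \<Rightarrow> real" where
  "max_scaled a m x = Max (insert (a * x $ m) ((\<lambda>k. x $ k) ` (UNIV - {m})))"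

end

theory Submission
  imports Defs
begin

text \<open>
  Up to null sets, each of the maxima involved has the form \<open>\<Or>\<^sub>k s\<^sub>k X\<^sub>k = \<Or>\<^sub>j b\<^sub>j Z\<^sub>j\<close> with
  \<open>b\<^sub>j = \<Or>\<^sub>k s\<^sub>k a\<^sub>k\<^sub>j\<close>, and independence gives it the squared scaling \<open>\<Sum>\<^sub>j b\<^sub>j\<^sup>2\<close>. Scaling row \<open>m\<close> by
  \<open>a\<close> increases the \<open>j\<close>-th summand by at most \<open>(a\<^sup>2 - 1) a\<^sub>m\<^sub>j\<^sup>2\<close>, and these bounds add up to \<open>a\<^sup>2 - 1\<close>
  because row \<open>m\<close> has norm 1. For an initial node, row \<open>m\<close> is a unit vector and the bound is
  attained. Otherwise \<open>m\<close> has an initial ancestor \<open>j\<close>, whose own row is a unit vector, so that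
  \<open>a\<^sub>j\<^sub>j = 1 > a\<^sub>m\<^sub>j > 0\<close>; then the bound for the \<open>j\<close>-th summand is strict.
\<close>

section \<open>Squared scalings of max-linear combinations\<close>

text \<open>For independent rare events of probability of order 1/n, joint occurrences are
  negligible, so the scaled probability of the union is additive in the limit. In the induction, 1 -
  (1 - x)(1 - q) = x + q - xq, and the cross term vanishes after scaling because q tends to
  0.\<close>

lemma tendsto_one_minus_prod:
  fixes x :: "'i \<Rightarrow> nat \<Rightarrow> real" and l :: "'i \<Rightarrow> real"
  assumes "finite I" and "\<And>i. i \<in> I \<Longrightarrow> (\<lambda>n. real n * x i n) \<longlonglongrightarrow> l i"
  shows "(\<lambda>n. real n * (1 - (\<Prod>i\<in>I. 1 - x i n))) \<longlonglongrightarrow> (\<Sum>i\<in>I. l i)"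
  using assms
proof (induction I rule: finite_induct)
  case empty
  then show ?case by simp
next
  case (insert i I)
  let ?q = "\<lambda>n. 1 - (\<Prod>i\<in>I. 1 - x i n)"
  have q: "(\<lambda>n. real n * ?q n) \<longlonglongrightarrow> (\<Sum>i\<in>I. l i)"
    using insert by simp
  have "(\<lambda>n. inverse (real n) * (real n * ?q n)) \<longlonglongrightarrow> 0 * (\<Sum>i\<in>I. l i)"
    by (intro tendsto_mult lim_inverse_n q)
  \<comment> \<open>Only eventually: at \<open>n = 0\<close> the left side is 0, whatever
    \<open>?q 0\<close> is.\<close>
  moreover have "\<forall>\<^sub>F n in sequentially. inverse (real n) * (real n * ?q n) = ?q n"
    using eventually_gt_at_top[of 0] by eventually_elim simp
  ultimately have q0: "?q \<longlonglongrightarrow> 0"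
    by (simp only: mult_zero_left tendsto_cong)
  have "(\<lambda>n. real n * x i n + real n * ?q n - real n * x i n * ?q n)
      \<longlonglongrightarrow> l i + (\<Sum>i\<in>I. l i) - l i * 0"
    using insert.prems by (intro tendsto_intros q q0) auto
  moreover have "real n * x i n + real n * ?q n - real n * x i n * ?q n =
      real n * (1 - (\<Prod>i\<in>insert i I. 1 - x i n))" for n
    using insert.hyps by (simp add: algebra_simps)
  ultimately show ?case
    using insert.hyps by simp
qed

lemma standardized_tail_mult:
  assumes "standardized_tail M Y" and "0 \<le> b"
  shows "scaling_seq M (\<lambda>w. b * Y w) \<longlonglongrightarrow> b\<^sup>2"
proof (cases "b = 0")
  case True
  \<comment> \<open>For \<open>b = 0\<close> the events \<open>sqrt n < 0\<close> are empty, so the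
    sequence is constantly 0.\<close>
  then show ?thesis by (simp add: scaling_seq_def[abs_def] not_less)
next
  case False
  with assms have b: "0 < b" by simp
  then have "(\<lambda>n. real n * measure M {w \<in> space M. 1 / b < Y w / sqrt (real n)}) \<longlonglongrightarrow> b\<^sup>2"
    using assms(1)[unfolded standardized_tail_def, rule_format, of "1 / b"]
    by (simp add: power_divide)
  moreover have "real n * measure M {w \<in> space M. 1 / b < Y w / sqrt (real n)} =
      scaling_seq M (\<lambda>w. b * Y w) n" for n
    \<comment> \<open>At \<open>n = 0\<close> the two events may differ, but the factor
      \<open>n\<close> makes both sides 0.\<close>
    using b by (cases "n = 0") (simp_all add: scaling_seq_def field_simps)
  ultimately show ?thesis by simp
qed

text \<open>A maximum stays below a threshold iff all its terms do, so independence factorizes the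
  probability; the tails of the single terms then add up by
  \<open>tendsto_one_minus_prod\<close>.\<close>

lemma (in prob_space) scaling_seq_Max_linear:
  fixes Z :: "'i::finite \<Rightarrow> 'a \<Rightarrow> real"
  assumes indep: "indep_vars (\<lambda>_. borel) Z UNIV"
    and tail: "\<And>j. standardized_tail M (Z j)"
    and b: "\<And>j. 0 \<le> b j"
  shows "scaling_seq M (\<lambda>w. Max (range (\<lambda>j. b j * Z j w))) \<longlonglongrightarrow> (\<Sum>j\<in>UNIV. (b j)\<^sup>2)"
proof -
  have [measurable]: "Z j \<in> borel_measurable M" for j
    using indep by (simp add: indep_vars_def)
  define x where "x j n = prob {w \<in> space M. sqrt (real n) < b j * Z j w}" for j n
  have compl: "prob {w \<in> space M. f w \<le> t} = 1 - prob {w \<in> space M. t < f w}"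
    if [measurable]: "f \<in> borel_measurable M" for f :: "'a \<Rightarrow> real" and t
    using prob_neg[of "\<lambda>w. t < f w"] by (simp add: not_less)
  have "prob {w \<in> space M. Max (range (\<lambda>j. b j * Z j w)) \<le> sqrt (real n)} =
      (\<Prod>j\<in>UNIV. 1 - x j n)" for n
  proof -
    let ?A = "\<lambda>j. {z. b j * z \<le> sqrt (real n)}"
    have "{w \<in> space M. Max (range (\<lambda>j. b j * Z j w)) \<le> sqrt (real n)} =
        (\<Inter>j\<in>UNIV. Z j -` ?A j \<inter> space M)"
      by auto
    also have "prob \<dots> = (\<Prod>j\<in>UNIV. prob (Z j -` ?A j \<inter> space M))"
      by (rule indep_varsD[OF indep]) auto
    also have "\<dots> = (\<Prod>j\<in>UNIV. prob {w \<in> space M. b j * Z j w \<le> sqrt (real n)})"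
      by (intro prod.cong refl arg_cong[of _ _ prob]) auto
    also have "\<dots> = (\<Prod>j\<in>UNIV. 1 - x j n)"
      by (simp add: compl x_def)
    finally show ?thesis .
  qed
  then have "scaling_seq M (\<lambda>w. Max (range (\<lambda>j. b j * Z j w))) =
      (\<lambda>n. real n * (1 - (\<Prod>j\<in>UNIV. 1 - x j n)))"
    using compl[of "\<lambda>w. Max (range (\<lambda>j. b j * Z j w))" "sqrt (real n)" for n]
    by (simp add: scaling_seq_def[abs_def])
  moreover have "(\<lambda>n. real n * x j n) \<longlonglongrightarrow> (b j)\<^sup>2" for j
    using standardized_tail_mult[OF tail[of j] b[of j]] by (simp add: scaling_seq_def[abs_def] x_def)
  ultimately show ?thesis
    using tendsto_one_minus_prod[of UNIV x "\<lambda>j. (b j)\<^sup>2"] by simp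
qed

text \<open>Needed because the max-linear representation is available only where the innovations are
  nonnegative, that is, almost surely.\<close>

lemma scaling_seq_cong_AE:
  assumes "AE w in M. Y w = Y' w" "Y \<in> borel_measurable M" "Y' \<in> borel_measurable M"
  shows "scaling_seq M Y = scaling_seq M Y'"
  unfolding scaling_seq_def
proof (intro ext arg_cong2[of _ _ _ _ "(*)"] refl measure_eq_AE)
  show "AE w in M. (w \<in> {w \<in> space M. sqrt (real n) < Y w}) =
      (w \<in> {w \<in> space M. sqrt (real n) < Y' w})" for n
    using assms(1) by eventually_elim simp
qed (use assms(2,3) in measurable)

text \<open>Brings this maximum to the form of a row scaling, so that one limit statement covers it
  and the plain maximum.\<close>

lemma max_scaled_conv_Max:
  fixes m :: "'m::finite"
  shows "max_scaled a m x = Max (range (\<lambda>k. (if k = m then a else 1) * x $ k))"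
proof -
  have "insert (a * x $ m) ((\<lambda>k. x $ k) ` (UNIV - {m})) =
      range (\<lambda>k. (if k = m then a else 1) * x $ k)"
  proof -
    have "range f = insert (f m) (f ` (UNIV - {m}))" for f :: "'m \<Rightarrow> real"
      by auto
    then show ?thesis
      by (auto intro!: arg_cong2[of _ _ _ _ insert] image_cong)
  qed
  then show ?thesis by (simp add: max_scaled_def)
qed

text \<open>Maxima over rows and columns commute, and the nonnegative factors \<open>s k\<close> and
  \<open>z $ j\<close> may be moved through them. Each inequality follows by choosing a maximizer of
  the inner maximum.\<close>

lemma Max_max_times:
  fixes A :: "real^'n::finite^'m::finite"
  assumes s: "\<And>k. 0 \<le> s k" and z: "\<And>j. 0 \<le> z $ j"
  shows "Max (range (\<lambda>k. s k * max_times A z $ k)) =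
    Max (range (\<lambda>j. Max (range (\<lambda>k. s k * A $ k $ j)) * z $ j))"
proof (rule antisym)
  have "s k * max_times A z $ k \<le> Max (range (\<lambda>j. Max (range (\<lambda>k. s k * A $ k $ j)) * z $ j))" for k
  proof -
    have "Max (range (\<lambda>j. A $ k $ j * z $ j)) \<in> range (\<lambda>j. A $ k $ j * z $ j)"
      by (rule Max_in) auto
    then obtain j where "Max (range (\<lambda>j. A $ k $ j * z $ j)) = A $ k $ j * z $ j"
      by (rule rangeE)
    then have "s k * max_times A z $ k = (s k * A $ k $ j) * z $ j"
      by (simp add: max_times_def)
    also have "\<dots> \<le> Max (range (\<lambda>k. s k * A $ k $ j)) * z $ j"
      by (intro mult_right_mono z Max_ge) auto
    also have "\<dots> \<le> Max (range (\<lambda>j. Max (range (\<lambda>k. s k * A $ k $ j)) * z $ j))"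
      by (intro Max_ge) auto
    finally show ?thesis .
  qed
  then show "Max (range (\<lambda>k. s k * max_times A z $ k)) \<le>
      Max (range (\<lambda>j. Max (range (\<lambda>k. s k * A $ k $ j)) * z $ j))"
    by simp
next
  have "Max (range (\<lambda>k. s k * A $ k $ j)) * z $ j \<le> Max (range (\<lambda>k. s k * max_times A z $ k))" for j
  proof -
    have "Max (range (\<lambda>k. s k * A $ k $ j)) \<in> range (\<lambda>k. s k * A $ k $ j)"
      by (rule Max_in) auto
    then obtain k where "Max (range (\<lambda>k. s k * A $ k $ j)) = s k * A $ k $ j"
      by (rule rangeE)
    then have "Max (range (\<lambda>k. s k * A $ k $ j)) * z $ j = s k * (A $ k $ j * z $ j)"
      by simp
    also have "\<dots> \<le> s k * max_times A z $ k"
      by (intro mult_left_mono s) (auto simp: max_times_def intro!: Max_ge)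
    also have "\<dots> \<le> Max (range (\<lambda>k. s k * max_times A z $ k))"
      by (intro Max_ge) auto
    finally show ?thesis .
  qed
  then show "Max (range (\<lambda>j. Max (range (\<lambda>k. s k * A $ k $ j)) * z $ j)) \<le>
      Max (range (\<lambda>k. s k * max_times A z $ k))"
    by simp
qed

text \<open>Measurability passes from parents to children along the recursion, by induction on the
  well-founded edge relation.\<close>

lemma recursive_ml_vector_measurable:
  fixes Z X :: "'w \<Rightarrow> real^'n::finite"
  assumes rml: "recursive_ml_vector M E c Z X"
    and Z [measurable]: "\<And>j. (\<lambda>w. Z w $ j) \<in> borel_measurable M"
  shows "(\<lambda>w. X w $ i) \<in> borel_measurable M"
proof -
  have "wf E"
    using rml by (intro finite_acyclic_wf) (auto simp: recursive_ml_vector_def)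
  then show ?thesis
  proof (induction i rule: wf_induct_rule)
    case (less i)
    \<comment> \<open>Since \<open>i\<close> is not its own parent, index \<open>i\<close> is free
      to carry the innovation term, which makes the recursion a maximum over one indexed
      family.\<close>
    let ?f = "\<lambda>k w. if k = i then c i i * Z w $ i else c i k * X w $ k"
    have i: "i \<notin> parents E i"
      using rml by (auto simp: recursive_ml_vector_def parents_def acyclic_def)
    have "X w $ i = Max ((\<lambda>k. ?f k w) ` insert i (parents E i))" if "w \<in> space M" for w
    proof -
      have "(\<lambda>k. ?f k w) ` parents E i = (\<lambda>k. c i k * X w $ k) ` parents E i"
        using i by (intro image_cong) auto
      moreover have "X w $ i = Max (insert (c i i * Z w $ i) ((\<lambda>k. c i k * X w $ k) ` parents E i))"
        using rml that unfolding recursive_ml_vector_def by blast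
      ultimately show ?thesis
        by (simp only: image_insert if_True simp_thms)
    qed
    moreover have "?f k \<in> borel_measurable M" if "k \<in> insert i (parents E i)" for k
      using that less.IH[of k] by (cases "k = i") (auto simp: parents_def)
    then have "(\<lambda>w. Max ((\<lambda>k. ?f k w) ` insert i (parents E i))) \<in> borel_measurable M"
      by (intro borel_measurable_Max) auto
    ultimately show ?case
      by (subst measurable_cong) auto
  qed
qed


section \<open>Coefficients of initial nodes\<close>

lemma ml_coeff_pos:
  fixes E :: "'n::finite rel"
  assumes "acyclic E" "positive_weights E c" "j = i \<or> j \<in> ancestors E i"
  shows "0 < ml_coeff E c i j"
proof (cases "j = i")
  case True
  then show ?thesis using assms(2) by (simp add: ml_coeff_def positive_weights_def)
next
  case False
  have "0 < path_weight c p" if p: "p \<in> paths E j i" for p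
  proof -
    have "0 < c (p ! Suc k) (p ! k)" if "k < length p - 1" for k
      using p that assms(2)
      by (auto simp: paths_def positive_weights_def parents_def successively_conv_nth)
    then show ?thesis
      using assms(2) by (auto simp: path_weight_def positive_weights_def intro!: mult_pos_pos prod_pos)
  qed
  moreover have "Max (path_weight c ` paths E j i) \<in> path_weight c ` paths E j i"
    using False assms trancl_imp_path[of j i E] finite_paths[OF assms(1)]
    by (intro Max_in) (auto simp: ancestors_def)
  ultimately show ?thesis
    using False assms(3) by (auto simp: ml_coeff_def)
qed

lemma ml_coeff_nonneg:
  fixes E :: "'n::finite rel"
  assumes "acyclic E" "positive_weights E c"
  shows "0 \<le> ml_coeff E c i j"
  using ml_coeff_pos[OF assms, of j i] by (cases "j = i \<or> j \<in> ancestors E i") (auto simp: ml_coeff_def)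

text \<open>Any chain of edges into \<open>i\<close> would end with an edge from a parent, so an
  initial node has no ancestors.\<close>

lemma ml_coeff_initial_node:
  assumes "initial_node E i" "j \<noteq> i"
  shows "ml_coeff E c i j = 0"
  using assms by (auto simp: ml_coeff_def ancestors_def initial_node_def parents_def dest: tranclD2)

text \<open>Take an ancestor that is minimal for \<open>E\<^sup>+\<close>: a parent of it would be a
  smaller ancestor of \<open>i\<close>.\<close>

lemma ex_initial_ancestor:
  fixes E :: "'n::finite rel"
  assumes "acyclic E" "\<not> initial_node E i"
  shows "\<exists>j\<in>ancestors E i. initial_node E j"
proof -
  have "wf (E\<^sup>+)"
    using assms(1) by (intro wf_trancl finite_acyclic_wf) auto
  moreover have "ancestors E i \<noteq> {}"
    using assms(2) by (auto simp: ancestors_def initial_node_def parents_def)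
  ultimately obtain j where "j \<in> ancestors E i" "\<And>k. (k, j) \<in> E\<^sup>+ \<Longrightarrow> k \<notin> ancestors E i"
    by (metis wfE_min ex_in_conv)
  then show ?thesis
    by (intro bexI[of _ j]) (auto simp: ancestors_def initial_node_def parents_def intro: trancl_into_trancl2)
qed

lemma sum_power2_eq_1:
  fixes x :: "real^'n"
  assumes "norm x = 1"
  shows "(\<Sum>j\<in>UNIV. (x $ j)\<^sup>2) = 1"
  using assms by (simp add: norm_vec_def L2_set_def)

lemma component_le_1:
  fixes x :: "real^'n"
  assumes "norm x = 1"
  shows "x $ j \<le> 1"
  using component_le_norm_cart[of x j] assms by simp

theorem theorem2:
  fixes M :: "'w measure"
    and E :: "('n::{finite,linorder}) rel"
    and c :: "'n \<Rightarrow> 'n \<Rightarrow> real"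
    and Z X\<^sub>\<nu> :: "'w \<Rightarrow> real^('n::{finite,linorder})"
    and \<nu> :: "'m::finite \<Rightarrow> 'n"
    and X :: "'w \<Rightarrow> real^'m"
    and A :: "(real, 'n) vec^'m"
  assumes "prob_space M"
    and "innovations M Z"
    and "well_ordered E"
    and "recursive_ml_vector M E c Z X\<^sub>\<nu>"
    and "bij \<nu>"
    and "\<And>i k. A $ i $ k = ml_coeff_matrix E c $ \<nu> i $ k"
    and "\<And>w i. w \<in> space M \<Longrightarrow> X w $ i = X\<^sub>\<nu> w $ \<nu> i"
    and "regularly_varying2 M Z"
    and "\<And>i. standardized_tail M (\<lambda>w. Z w $ i)"
    and "\<And>i. norm (A $ i) = 1"
  shows "convergent (scaling_seq M (\<lambda>w. max_all (X w))) \<and>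
     (\<forall>a>0. \<forall>m. convergent (scaling_seq M (\<lambda>w. max_scaled a m (X w)))) \<and>
     (\<forall>m. initial_node E (\<nu> m) \<longrightarrow>
        (\<forall>a>1. sq_scaling M (\<lambda>w. max_scaled a m (X w)) - sq_scaling M (\<lambda>w. max_all (X w))
                = a\<^sup>2 - 1)) \<and>
     (\<forall>m. (\<exists>a>1. sq_scaling M (\<lambda>w. max_scaled a m (X w)) - sq_scaling M (\<lambda>w. max_all (X w))
                = a\<^sup>2 - 1) \<longrightarrow>
        initial_node E (\<nu> m))"
proof -
  interpret prob_space M by (fact assms(1))

  \<comment> \<open>Innovations and rows of the coefficient matrix\<close>
  have indep: "indep_vars (\<lambda>_. borel) (\<lambda>j w. Z w $ j) UNIV"
    using assms(2) by (simp add: innovations_def)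
  then have [measurable]: "(\<lambda>w. Z w $ j) \<in> borel_measurable M" for j
    by (simp add: indep_vars_def)
  have nonneg: "AE w in M. \<forall>j. 0 \<le> Z w $ j"
    using assms(8) by (simp add: regularly_varying2_def)
  have acyc: "acyclic E" and wts: "positive_weights E c"
    using assms(4) by (auto simp: recursive_ml_vector_def)
  have A: "A $ k $ j = ml_coeff E c (\<nu> k) j" for k j
    using assms(6) by (simp add: ml_coeff_matrix_def)
  have A_nonneg: "0 \<le> A $ k $ j" for k j
    using ml_coeff_nonneg[OF acyc wts] by (simp add: A)
  note A_le = component_le_1[OF assms(10)]
  have A_sum: "(\<Sum>j\<in>UNIV. (A $ k $ j)\<^sup>2) = 1" for k
    by (rule sum_power2_eq_1[OF assms(10)])
  have unit_row: "A $ k $ j = (if j = \<nu> k then 1 else 0)" if "initial_node E (\<nu> k)" for k j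
  proof -
    have off: "A $ k $ j = 0" if "j \<noteq> \<nu> k" for j
      using ml_coeff_initial_node[OF \<open>initial_node E (\<nu> k)\<close> that] by (simp add: A)
    have "(\<Sum>j\<in>UNIV. (A $ k $ j)\<^sup>2) = (\<Sum>j\<in>{\<nu> k}. (A $ k $ j)\<^sup>2)"
      by (rule sum.mono_neutral_right) (use off in auto)
    \<comment> \<open>The only entry left carries the whole norm of the row; nonnegativity excludes
      the root -1.\<close>
    then have "(A $ k $ \<nu> k)\<^sup>2 = 1"
      using A_sum[of k] by simp
    then have "A $ k $ \<nu> k = 1"
      using A_nonneg[of k "\<nu> k"] by (auto simp: power2_eq_1_iff)
    then show ?thesis using off by auto
  qed

  \<comment> \<open>Squared scalings of maxima with scaled rows\<close>
  define b where "b s j = Max (range (\<lambda>k. s k * A $ k $ j))" for s :: "'m \<Rightarrow> real" and j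
  have b_ge: "s k * A $ k $ j \<le> b s j" for s k j
    by (auto simp: b_def intro!: Max_ge)
  have b_attained: "\<exists>k. b s j = s k * A $ k $ j" for s j
  proof -
    have "b s j \<in> range (\<lambda>k. s k * A $ k $ j)"
      unfolding b_def by (rule Max_in) auto
    then show ?thesis by auto
  qed
  have b_nonneg: "0 \<le> b s j" if "\<And>k. 0 \<le> s k" for s j
  proof -
    have "0 \<le> s k * A $ k $ j" for k
      using that A_nonneg by simp
    then show ?thesis
      using b_ge order_trans by blast
  qed

  have lim: "scaling_seq M (\<lambda>w. Max (range (\<lambda>k. s k * X w $ k))) \<longlonglongrightarrow> (\<Sum>j\<in>UNIV. (b s j)\<^sup>2)"
    if s: "\<And>k. 0 \<le> s k" for s
  proof -
    have [measurable]: "(\<lambda>w. X w $ k) \<in> borel_measurable M" for k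
      using recursive_ml_vector_measurable[OF assms(4), of "\<nu> k"] assms(7)
      by (subst measurable_cong) auto
    \<comment> \<open>Nonnegativity of \<open>Z\<close>, required by the max-linear representation,
      comes from regular variation and holds almost everywhere.\<close>
    have "AE w in M. Max (range (\<lambda>k. s k * X w $ k)) = Max (range (\<lambda>j. b s j * Z w $ j))"
      using nonneg AE_space
    proof eventually_elim
      case (elim w)
      then have "X w = max_times A (Z w)"
        using recursive_ml_vector_max_times[OF assms(4), of w]
        by (simp add: vec_eq_iff assms(6,7) max_times_def)
      then show ?case
        using Max_max_times[of s "Z w" A] elim s by (simp add: b_def)
    qed
    then have "scaling_seq M (\<lambda>w. Max (range (\<lambda>k. s k * X w $ k))) =
        scaling_seq M (\<lambda>w. Max (range (\<lambda>j. b s j * Z w $ j)))"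
      by (rule scaling_seq_cong_AE) measurable
    then show ?thesis
      using scaling_seq_Max_linear[OF indep assms(9), of "b s"] b_nonneg s by simp
  qed

  define s where "s a m k = (if k = m then a else 1)" for a :: real and m k :: 'm
  let ?one = "\<lambda>_::'m. 1::real"
  have lim_all: "scaling_seq M (\<lambda>w. max_all (X w)) \<longlonglongrightarrow> (\<Sum>j\<in>UNIV. (b ?one j)\<^sup>2)"
    using lim[of ?one] by (simp add: max_all_def)
  have lim_scaled: "scaling_seq M (\<lambda>w. max_scaled a m (X w)) \<longlonglongrightarrow> (\<Sum>j\<in>UNIV. (b (s a m) j)\<^sup>2)"
    if "0 < a" for a m
    using lim[of "s a m"] that by (simp add: max_scaled_conv_Max s_def)
  have diff: "sq_scaling M (\<lambda>w. max_scaled a m (X w)) - sq_scaling M (\<lambda>w. max_all (X w)) =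
      (\<Sum>j\<in>UNIV. (b (s a m) j)\<^sup>2 - (b ?one j)\<^sup>2)" if "1 < a" for a m
    using limI[OF lim_all] limI[OF lim_scaled[of a m]] that
    by (simp add: sq_scaling_def sum_subtractf)

  \<comment> \<open>Initial nodes: the bound is attained\<close>
  have initial: "(\<Sum>j\<in>UNIV. (b (s a m) j)\<^sup>2 - (b ?one j)\<^sup>2) = a\<^sup>2 - 1"
    if "initial_node E (\<nu> m)" "1 < a" for a m
  proof -
    note row = unit_row[OF that(1)]
    \<comment> \<open>Row \<open>m\<close> vanishes outside column \<open>\<nu> m\<close>, so
      scaling it changes no other column.\<close>
    have "b (s a m) j = b ?one j" if "j \<noteq> \<nu> m" for j
      unfolding b_def by (intro arg_cong[of _ _ Max] image_cong) (auto simp: s_def row that)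
    \<comment> \<open>In column \<open>\<nu> m\<close>, row \<open>m\<close> contributes
      \<open>t\<close>, and the other rows at most 1. Taking \<open>t = a\<close> and
      \<open>t = 1\<close> covers both maxima.\<close>
    moreover have val: "b (s t m) (\<nu> m) = t" if "1 \<le> t" for t
      unfolding b_def
    proof (rule Max_eqI)
      show "t \<in> range (\<lambda>k. s t m k * A $ k $ \<nu> m)"
        by (intro image_eqI[of _ _ m]) (auto simp: s_def row)
    qed (use that in \<open>auto simp: s_def row intro: order_trans[OF A_le]\<close>)
    have "s 1 m = ?one"
      by (auto simp: s_def)
    with val[of a] val[of 1] \<open>1 < a\<close> have "b (s a m) (\<nu> m) = a" "b ?one (\<nu> m) = 1"
      by simp_all
    ultimately have "(\<Sum>j\<in>UNIV. (b (s a m) j)\<^sup>2 - (b ?one j)\<^sup>2) =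
        (\<Sum>j\<in>UNIV. if j = \<nu> m then a\<^sup>2 - 1 else 0)"
      by (intro sum.cong) auto
    then show ?thesis by simp
  qed

  \<comment> \<open>Other nodes: the bound is strict\<close>
  have not_initial: "(\<Sum>j\<in>UNIV. (b (s a m) j)\<^sup>2 - (b ?one j)\<^sup>2) < a\<^sup>2 - 1"
    if m: "\<not> initial_node E (\<nu> m)" and a: "1 < a" for a m
  proof -
    have a2: "1 < a\<^sup>2"
      using a by simp
    \<comment> \<open>The maximizing row is either \<open>m\<close> or a row with scale 1, whose
      entry already competes in \<open>b ?one j\<close>.\<close>
    have cases: "b (s a m) j \<le> b ?one j \<or> b (s a m) j = a * A $ m $ j" for j
    proof -
      obtain k where "b (s a m) j = s a m k * A $ k $ j"
        using b_attained by blast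
      then show ?thesis
        using b_ge[of ?one k j] by (cases "k = m") (auto simp: s_def)
    qed
    have s_nonneg: "0 \<le> b (s a m) j" for j
      using a by (intro b_nonneg) (auto simp: s_def)
    have le: "(b (s a m) j)\<^sup>2 - (b ?one j)\<^sup>2 \<le> (a\<^sup>2 - 1) * (A $ m $ j)\<^sup>2" for j
      using cases[of j]
    proof
      assume "b (s a m) j \<le> b ?one j"
      then have "(b (s a m) j)\<^sup>2 \<le> (b ?one j)\<^sup>2"
        using s_nonneg by (rule power_mono)
      moreover have "0 \<le> (a\<^sup>2 - 1) * (A $ m $ j)\<^sup>2"
        using a2 by simp
      ultimately show ?thesis by linarith
    next
      assume "b (s a m) j = a * A $ m $ j"
      moreover have "(A $ m $ j)\<^sup>2 \<le> (b ?one j)\<^sup>2"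
        using b_ge[of ?one m j] A_nonneg by (intro power_mono) auto
      ultimately show ?thesis by (simp add: algebra_simps)
    qed
    obtain j where j: "j \<in> ancestors E (\<nu> m)" "initial_node E j"
      using ex_initial_ancestor[OF acyc m] by blast
    obtain k where k: "\<nu> k = j"
      using assms(5) by (metis bij_pointE)
    have jm: "j \<noteq> \<nu> m"
      using j(1) acyc by (auto simp: ancestors_def acyclic_def)
    have pos: "0 < A $ m $ j" "0 < A $ m $ \<nu> m"
      using ml_coeff_pos[OF acyc wts] j(1) by (auto simp: A)
    \<comment> \<open>Row \<open>m\<close> has positive entries in the two distinct columns
      \<open>j\<close> and \<open>\<nu> m\<close>; as its norm is 1, the first must be below
      1.\<close>
    have "(\<Sum>l\<in>{j, \<nu> m}. (A $ m $ l)\<^sup>2) \<le> (\<Sum>l\<in>UNIV. (A $ m $ l)\<^sup>2)"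
      by (rule sum_mono2) auto
    then have "(A $ m $ j)\<^sup>2 + (A $ m $ \<nu> m)\<^sup>2 \<le> 1"
      using jm A_sum[of m] by simp
    moreover have "0 < (A $ m $ \<nu> m)\<^sup>2"
      using pos by simp
    ultimately have A_less: "(A $ m $ j)\<^sup>2 < 1"
      by linarith
    have b1: "1 \<le> (b ?one j)\<^sup>2"
      using b_ge[of ?one k j] unit_row[of k j] j(2) k by (simp add: one_le_power)
    \<comment> \<open>If the scaling does not raise the coefficient, the right side is positive
      because \<open>A $ m $ j\<close> is. Otherwise the subtracted square is at least 1 and so
      exceeds \<open>(A $ m $ j)\<^sup>2\<close>.\<close>
    have "(b (s a m) j)\<^sup>2 - (b ?one j)\<^sup>2 < (a\<^sup>2 - 1) * (A $ m $ j)\<^sup>2"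
      using cases[of j]
    proof
      assume "b (s a m) j \<le> b ?one j"
      then have "(b (s a m) j)\<^sup>2 \<le> (b ?one j)\<^sup>2"
        using s_nonneg by (rule power_mono)
      moreover have "0 < (a\<^sup>2 - 1) * (A $ m $ j)\<^sup>2"
        using a2 pos by simp
      ultimately show ?thesis by linarith
    next
      assume "b (s a m) j = a * A $ m $ j"
      then show ?thesis
        using A_less b1 by (simp add: algebra_simps)
    qed
    then have "(\<Sum>j\<in>UNIV. (b (s a m) j)\<^sup>2 - (b ?one j)\<^sup>2) < (\<Sum>j\<in>UNIV. (a\<^sup>2 - 1) * (A $ m $ j)\<^sup>2)"
      by (intro sum_strict_mono_ex1) (use le in auto)
    also have "\<dots> = a\<^sup>2 - 1"
      using A_sum[of m] by (simp flip: sum_distrib_left)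
    finally show ?thesis .
  qed

  show ?thesis
  proof (intro conjI allI impI)
    show "convergent (scaling_seq M (\<lambda>w. max_all (X w)))"
      using lim_all by (rule convergentI)
    show "convergent (scaling_seq M (\<lambda>w. max_scaled a m (X w)))" if "0 < a" for a m
      using lim_scaled[OF that] by (rule convergentI)
    show "sq_scaling M (\<lambda>w. max_scaled a m (X w)) - sq_scaling M (\<lambda>w. max_all (X w)) = a\<^sup>2 - 1"
      if "initial_node E (\<nu> m)" "1 < a" for a m
      using diff[of a m] initial[of m a] that by simp
    show "initial_node E (\<nu> m)"
      if "\<exists>a>1. sq_scaling M (\<lambda>w. max_scaled a m (X w)) - sq_scaling M (\<lambda>w. max_all (X w)) = a\<^sup>2 - 1"
      for m
      \<comment> \<open>By contraposition: at a node that is not initial, the strict bound rules out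
        equality for every \<open>a > 1\<close>.\<close>
      using that diff[of _ m] not_initial[of m] by fastforce
  qed
qed

end
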